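(* Let $k>1$ be an integer and $\sigma$ a permutation of $\{0,1,2,3\}$. A $4$-digit $(\sigma,k)$-permutiple $[a_0;a_1,a_2,a_3]$ is symmetric if and only if it is either perfect or a $k$-reverse multiple.
   Context: For positive integers $a_0,\ldots,a_n$, $[a_0;a_1,\ldots,a_n]$ denotes the finite simple continued fraction $a_0+1/(a_1+1/(\cdots+1/a_n))$; all finite continued fractions are assumed in canonical form (last digit at least $2$ when there are at least two digits). For an integer $k>1$ and a permutation $\sigma$ of $\{0,\ldots,n\}$, $r=[a_0;\ldots,a_n]$ is a $(\sigma,k)$-permutiple if $r=k\,[a_{\sigma(0)};a_{\sigma(1)},\ldots,a_{\sigma(n)}]$. It is symmetric if $a_ja_{n-j}=a_{\sigma(j)}a_{\sigma(n-j)}$ for all $0\le j\le n$; perfect if $a_j=k\,a_{\sigma(j)}$ for every even $j$ and $a_{\sigma(j)}=k\,a_j$ for every odd $j$; and a $k$-reverse multiple if $\sigma(j)=n-j$ for all $j$.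
   Formalization: "k-reverse multiple" is read as: the number is a permutiple for the reversal permutation, not that the given σ itself is the reversal; the literal claim fails when digits repeat, e.g. [7;1,1,2] = 3[2;1,1,7] with σ swapping 0 and 3. *)

theory Defs
  imports Complex_Main "HOL-Combinatorics.Permutations"
begin

text \<open>
  The digit string $a_0, \ldots, a_n$ is a list \<open>as\<close> with \<open>n = length as - 1\<close>. The value on the
  empty list is a dummy; it is excluded by \<open>canonical_cf\<close>.
\<close>

fun cf_value :: "nat list \<Rightarrow> real" where
  "cf_value [] = 0"
| "cf_value [a] = real a"
| "cf_value (a # b # as) = real a + 1 / cf_value (b # as)"

definition canonical_cf :: "nat list \<Rightarrow> bool" where
  "canonical_cf as \<longleftrightarrow>
     as \<noteq> [] \<and> (\<forall>a \<in> set as. a > 0) \<and> (length as \<ge> 2 \<longrightarrow> last as \<ge> 2)"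

text \<open>
  \<open>permute_list \<sigma> as\<close> is the list $a_{\sigma(0)}, \ldots, a_{\sigma(n)}$. Both continued fractions
  in the defining equation are required to be canonical.
\<close>

definition permutiple :: "(nat \<Rightarrow> nat) \<Rightarrow> nat \<Rightarrow> nat list \<Rightarrow> bool" where
  "permutiple \<sigma> k as \<longleftrightarrow>
     k > 1 \<and> \<sigma> permutes {..<length as} \<and>
     canonical_cf as \<and> canonical_cf (permute_list \<sigma> as) \<and>
     cf_value as = real k * cf_value (permute_list \<sigma> as)"

definition symmetric_permutiple :: "(nat \<Rightarrow> nat) \<Rightarrow> nat \<Rightarrow> nat list \<Rightarrow> bool" where
  "symmetric_permutiple \<sigma> k as \<longleftrightarrow>
     permutiple \<sigma> k as \<and>
     (let n = length as - 1 in
        \<forall>j \<le> n. as ! j * as ! (n - j) = as ! \<sigma> j * as ! \<sigma> (n - j))"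

definition perfect_permutiple :: "(nat \<Rightarrow> nat) \<Rightarrow> nat \<Rightarrow> nat list \<Rightarrow> bool" where
  "perfect_permutiple \<sigma> k as \<longleftrightarrow>
     permutiple \<sigma> k as \<and>
     (let n = length as - 1 in
        (\<forall>j \<le> n. even j \<longrightarrow> as ! j = k * as ! \<sigma> j) \<and>
        (\<forall>j \<le> n. odd j \<longrightarrow> as ! \<sigma> j = k * as ! j))"

text \<open>
  Being a \<open>k\<close>-reverse multiple is a property of the number $[a_0; \ldots, a_n]$: it is a
  permutiple for the reversal permutation. When digits repeat, several permutations
  describe the same rearrangement of the digits; for instance $[7;1,1,2] = 3\,[2;1,1,7]$ is
  witnessed by the reversal and also by the transposition of \<open>0\<close> and \<open>3\<close>. Demanding that one
  particular witness be the reversal would make the notion depend on that choice, unlike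
  symmetry and perfection, which only involve the digits.
\<close>

definition reverse_multiple :: "nat \<Rightarrow> nat list \<Rightarrow> bool" where
  "reverse_multiple k as \<longleftrightarrow>
     (\<exists>\<tau>. permutiple \<tau> k as \<and>
        (let n = length as - 1 in \<forall>j \<le> n. \<tau> j = n - j))"

end

theory Submission
  imports Defs
begin

text \<open>
  Write $[a;b,c,d] = N/D$ with coprime $N = abcd + ad + 1 + ab + cd$ and $D = d(bc+1) + b$, and
  $N'/D'$ for the permuted digits $p,q,r,s$. From $N D' = k N' D$ one gets $N' \mid N$. Symmetry
  means $ps = ad$ and $qr = bc$, so $N$ and $N'$ differ only in $ab + cd$ versus $pq + rs$; since
  $ab + cd \le abcd + 1$, this forces $N < 2N'$, hence $N = N'$ and $D' = kD$. Up to coincidences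
  among the digits, symmetry leaves $\{p,s\} = \{a,d\}$ or $\{p,s\} = \{b,c\}$; together with
  $pq + rs = ab + cd$ and $D' = kD$ only reversal and the perfect arrangement survive. Conversely,
  a reverse multiple is symmetric for every witness because canonical expansions are unique.
\<close>

section \<open>Uniqueness of canonical continued fraction expansions\<close>

lemma canonical_cf_Cons:
  "canonical_cf (a # b # as) \<longleftrightarrow> a > 0 \<and> canonical_cf (b # as) \<and> (b # as) \<noteq> [1]"
  by (cases as) (auto simp: canonical_cf_def)

text \<open>Strictness away from \<open>[1]\<close> is what later keeps the reciprocal of a
  canonical tail below 1, so that the floor reads off the leading digit.\<close>

lemma cf_value_ge_1:
  assumes "canonical_cf as"
  shows "cf_value as \<ge> 1 \<and> (as \<noteq> [1] \<longrightarrow> cf_value as > 1)"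
  using assms
proof (induction as rule: cf_value.induct)
  case (3 a b as)
  have "cf_value (b # as) \<ge> 1" "a > 0"
    using 3 by (auto simp: canonical_cf_Cons)
  hence "real a \<ge> 1" "1 / cf_value (b # as) > 0"
    by auto
  hence "cf_value (a # b # as) > 1"
    unfolding cf_value.simps by linarith
  thus ?case by simp
qed (auto simp: canonical_cf_def)

lemma floor_cf_value:
  assumes "canonical_cf (a # as)"
  shows "\<lfloor>cf_value (a # as)\<rfloor> = int a"
proof (cases as)
  case (Cons b bs)
  have "cf_value (b # bs) > 1"
    using assms cf_value_ge_1 Cons by (simp add: canonical_cf_Cons)
  thus ?thesis
    using Cons by (simp add: floor_eq_iff)
qed auto

text \<open>The floor determines the leading digit; cancelling it equates the reciprocals of the
  tails. A one-digit expansion cannot equal a longer one, because the reciprocal of a tail is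
  positive.\<close>

lemma cf_value_inject:
  assumes "canonical_cf as" "canonical_cf bs" "cf_value as = cf_value bs"
  shows "as = bs"
  using assms
proof (induction as arbitrary: bs)
  case Nil
  thus ?case by (simp add: canonical_cf_def)
next
  case (Cons a as)
  obtain b bs' where bs: "bs = b # bs'"
    using Cons.prems(2) by (cases bs) (auto simp: canonical_cf_def)
  have ab: "a = b"
    using floor_cf_value[of a as] floor_cf_value[of b bs'] Cons.prems bs by simp
  have tail: "1 / cf_value (y # ys) > 0" if "canonical_cf (x # y # ys)" for x y ys
    using that cf_value_ge_1[of "y # ys"] by (simp add: canonical_cf_Cons)
  show ?case
  proof (cases as)
    case Nil
    thus ?thesis
      using Cons.prems bs ab tail by (cases bs') force+
  next
    case as: (Cons x xs)
    obtain y ys where ys: "bs' = y # ys"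
      using Cons.prems bs ab tail[of a x xs] as by (cases bs') auto
    have "as = bs'"
      using Cons.prems bs ab as ys by (intro Cons.IH) (auto simp: canonical_cf_Cons)
    thus ?thesis using bs ab by simp
  qed
qed

section \<open>The value of four digits as a reduced fraction\<close>

lemma cf_value_4:
  assumes "b > 0" "c > 0" "d > 0"
  shows "cf_value [a, b, c, d] =
    real (a*b*c*d + a*d + 1 + a*b + c*d) / real (d * (b*c + 1) + b)"
proof -
  have pos: "real c * real d + 1 > 0" "real b * (real c * real d + 1) + real d > 0"
    using assms by (auto intro!: add_nonneg_pos)
  have "cf_value [a, b, c, d] = real a + 1 / (real b + 1 / (real c + 1 / real d))"
    by simp
  also have "real c + 1 / real d = (real c * real d + 1) / real d"
    using assms by (simp add: field_simps)
  also have "real b + 1 / \<dots> = (real b * (real c * real d + 1) + real d) / (real c * real d + 1)"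
    using pos assms by (simp add: add_divide_eq_iff)
  also have "real a + 1 / \<dots> = (real a * (real b * (real c * real d + 1) + real d)
      + (real c * real d + 1)) / (real b * (real c * real d + 1) + real d)"
    using pos by (simp add: add_divide_eq_iff)
  finally show ?thesis by (simp add: algebra_simps)
qed

text \<open>Euclidean steps: the remainders are first \<open>c*d + 1\<close>, then \<open>d\<close>,
  and a common divisor of these two divides 1.\<close>

lemma coprime_numerator_denominator_4:
  fixes a b c d :: nat
  shows "coprime (a*b*c*d + a*d + 1 + a*b + c*d) (d * (b*c + 1) + b)"
proof (rule coprimeI)
  fix e assume N: "e dvd a*b*c*d + a*d + 1 + a*b + c*d" and D: "e dvd d * (b*c + 1) + b"
  have "a*b*c*d + a*d + 1 + a*b + c*d = a * (d * (b*c + 1) + b) + (c*d + 1)"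
    by (simp add: algebra_simps)
  hence e1: "e dvd c*d + 1"
    using N D by (metis dvd_add_right_iff dvd_mult)
  have "d * (b*c + 1) + b = b * (c*d + 1) + d"
    by (simp add: algebra_simps)
  hence "e dvd d"
    using e1 D by (metis dvd_add_right_iff dvd_mult)
  thus "is_unit e"
    using e1 by (metis dvd_add_right_iff dvd_mult)
qed

section \<open>Comparison of numerators and denominators under symmetry\<close>

lemma sum_le_prod_plus_1:
  fixes x y :: nat
  assumes "x > 0" "y > 0"
  shows "x + y \<le> x * y + 1"
  using assms by (cases x; cases y) auto

lemma symmetric_numerators_eq:
  fixes a b c d p q r s k :: nat
  assumes pos: "a > 0" "b > 0" "c > 0" "d > 0"
    and ps: "p * s = a * d" and qr: "q * r = b * c"
    and eq: "(a*b*c*d + a*d + 1 + a*b + c*d) * (s * (q*r + 1) + q) =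
      k * (p*q*r*s + p*s + 1 + p*q + r*s) * (d * (b*c + 1) + b)"
  shows "p*q + r*s = a*b + c*d" "s * (b*c + 1) + q = k * (d * (b*c + 1) + b)"
proof -
  define N where "N = a*b*c*d + a*d + 1 + a*b + c*d"
  define N' where "N' = p*q*r*s + p*s + 1 + p*q + r*s"
  have "N' dvd N * (s * (q*r + 1) + q)"
    using eq unfolding N_def N'_def by (metis dvd_mult2 dvd_triv_right mult.commute)
  moreover have "coprime N' (s * (q*r + 1) + q)"
    unfolding N'_def by (rule coprime_numerator_denominator_4)
  ultimately obtain t where t: "N = N' * t"
    using coprime_dvd_mult_left_iff by (metis dvdE)
  have "p*q*r*s = (p*s) * (q*r)" by simp
  hence N': "N' = a*b*c*d + a*d + 1 + p*q + r*s"
    unfolding N'_def by (simp add: ps qr)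
  have "a*b + c*d \<le> a*b*c*d + 1"
    using sum_le_prod_plus_1[of "a*b" "c*d"] pos by (simp add: mult.assoc)
  moreover have "a * d > 0" using pos by simp
  \<comment> \<open>Here \<open>K\<close> is the product of all four digits and \<open>z\<close> is
    \<open>a * d\<close>, both common to the two numerators; the sums \<open>x + y\<close> and
    \<open>u + v\<close> are where they may differ.\<close>
  moreover have "K + z + 1 + x + y < 2 * (K + z + 1 + u + v)"
    if "x + y \<le> K + 1" "z > 0" for K x y z u v :: nat
    using that by presburger
  ultimately have "N < 2 * N'"
    unfolding N_def N' by blast
  hence "t < 2" using t by simp
  moreover have "t \<noteq> 0" using t by (intro notI) (simp add: N_def)
  ultimately have NN: "N = N'" using t by (cases "t = 1") auto
  thus "p*q + r*s = a*b + c*d" unfolding N_def N' by linarith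
  have "N * (s * (q*r + 1) + q) = N * (k * (d * (b*c + 1) + b))"
    using eq NN unfolding N_def N'_def by (simp only: ac_simps)
  moreover have "N \<noteq> 0" by (simp add: N_def)
  ultimately show "s * (b*c + 1) + q = k * (d * (b*c + 1) + b)"
    using qr by (metis mult_cancel1)
qed

text \<open>Modulo \<open>b\<close> the equation reads $(k-1)d \equiv 0$, so $b \le (k-1)d$; then its left side is too
  small.\<close>

lemma swapped_denominators_not_multiple:
  fixes b c d k :: nat
  assumes "k > 1" "b > 0" "d > 0"
  shows "b * (b*c + 1) + d \<noteq> k * (d * (b*c + 1) + b)"
proof
  assume eq: "b * (b*c + 1) + d = k * (d * (b*c + 1) + b)"
  obtain j where k: "k = Suc j" "j > 0"
    using assms by (cases k) auto
  have "b * (b*c + 1) + d = b * (k*d*c + k) + j * d + d"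
    using eq k by (simp add: algebra_simps)
  hence "b * (b*c + 1) = b * (k*d*c + k) + j * d" by simp
  hence "b dvd j * d"
    by (metis dvd_add_right_iff dvd_triv_left)
  hence "b \<le> j * d"
    using k assms by (intro dvd_imp_le) auto
  hence "b * (b*c + 1) \<le> j * d * (b*c + 1)"
    by (rule mult_right_mono) simp
  moreover have "d \<le> d * (b*c + 1)" by simp
  moreover have "k * b > 0" using assms by simp
  \<comment> \<open>The first two summands on the right dominate the two on the left of
    \<open>eq\<close>, and \<open>k * b\<close> makes the inequality strict.\<close>
  moreover have "k * (d * (b*c + 1) + b) = j * d * (b*c + 1) + d * (b*c + 1) + k * b"
    using k by (simp add: algebra_simps)
  ultimately show False using eq by linarith
qed

section \<open>Possible arrangements of the digits\<close>

lemma crossed_sums_eq: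
  fixes a b c d :: nat
  assumes "a * b + c * d = a * c + b * d"
  shows "a = d \<or> b = c"
proof -
  \<comment> \<open>The difference of the two sides factors; integers avoid truncated
    subtraction.\<close>
  have "(int a - int d) * (int b - int c) = int (a * b + c * d) - int (a * c + b * d)"
    by (simp add: algebra_simps)
  thus ?thesis using assms by simp
qed

text \<open>If \<open>p\<close>, \<open>s\<close> were one digit from \<open>a\<close>,
  \<open>d\<close> and one from \<open>b\<close>, \<open>c\<close>, cancelling the shared positive
  digit in \<open>p * s = a * d\<close> would equate the other two, so the pair is \<open>a\<close>,
  \<open>d\<close> after all.\<close>

lemma mset_split_outer_inner:
  fixes a b c d p q r s :: nat
  assumes "{#p, q, r, s#} = {#a, b, c, d#}" "p * s = a * d" "a > 0" "b > 0" "c > 0" "d > 0"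
  shows "({#p, s#} = {#a, d#} \<and> {#q, r#} = {#b, c#}) \<or>
         ({#p, s#} = {#b, c#} \<and> {#q, r#} = {#a, d#})"
  using assms by (auto simp: add_eq_conv_ex)

lemma symmetric_digits:
  fixes a b c d p q r s k :: nat
  assumes k: "k > 1" and pos: "a > 0" "b > 0" "c > 0" "d > 0"
    and ms: "{#p, q, r, s#} = {#a, b, c, d#}"
    and ps: "p * s = a * d" and qr: "q * r = b * c"
    and sums: "p*q + r*s = a*b + c*d"
    and den: "s * (b*c + 1) + q = k * (d * (b*c + 1) + b)"
  shows "(a = k*p \<and> q = k*b \<and> c = k*r \<and> s = k*d) \<or> (p = d \<and> q = c \<and> r = b \<and> s = a)"
  using mset_split_outer_inner[OF ms ps pos]
proof (elim disjE conjE)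
  assume out: "{#p, s#} = {#a, d#}" and inn: "{#q, r#} = {#b, c#}"
  \<comment> \<open>If \<open>s = d\<close>, the left side of \<open>den\<close> exceeds
    \<open>d * (b*c + 1)\<close> only by \<open>q\<close>, which is at most \<open>b*c\<close>; the
    right side contains at least two copies of \<open>d * (b*c + 1)\<close>.\<close>
  have "s \<noteq> d"
  proof
    assume [simp]: "s = d"
    have "q \<le> b * c"
      using qr pos by (metis dvd_imp_le dvd_triv_left mult_pos_pos)
    moreover have "d * (b*c + 1) \<ge> b*c + 1" using pos by (cases d) auto
    moreover have "2 * (d * (b*c + 1) + b) \<le> k * (d * (b*c + 1) + b)"
      using k by (intro mult_right_mono) auto
    ultimately show False using den by simp
  qed
  hence "p = d" "s = a"
    using out by (auto simp: add_eq_conv_ex)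
  \<comment> \<open>In the other order, \<open>sums\<close> gives \<open>a = d\<close> or
    \<open>b = c\<close>; the former contradicts \<open>s \<noteq> d\<close>, the latter makes both
    orders coincide.\<close>
  moreover have "q = c \<and> r = b"
    using inn crossed_sums_eq[of a b c d] sums \<open>s \<noteq> d\<close> \<open>p = d\<close> \<open>s = a\<close>
    by (auto simp: add_eq_conv_ex ac_simps)
  ultimately show ?thesis by simp
next
  assume out: "{#p, s#} = {#b, c#}" and inn: "{#q, r#} = {#a, d#}"
  have ad: "a * d = b * c"
    using out ps by (auto simp: add_eq_conv_ex ac_simps)
  have "\<not> (s = b \<and> q = d)"
    using swapped_denominators_not_multiple[OF k] pos den by blast
  \<comment> \<open>If exactly one pair is in the wrong order, \<open>sums\<close> forces
    \<open>a = d\<close> or \<open>b = c\<close>: the arrangement is then either the claimed one or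
    the excluded one.\<close>
  hence digits: "p = b" "q = a" "r = d" "s = c"
    using out inn crossed_sums_eq[of a b c d] sums by (auto simp: add_eq_conv_ex ac_simps)
  have "c * (d * (b*c + 1) + b) = d * (c * (b*c + 1) + a)"
    using ad by (simp add: algebra_simps)
  also have "\<dots> = (k * d) * (d * (b*c + 1) + b)"
    using den digits by simp
  finally have c: "c = k * d" using pos by (simp del: mult_Suc_right)
  hence "a = k * b" using ad pos by simp
  thus ?thesis using digits c by simp
qed

theorem theorem16:
  fixes k :: nat and \<sigma> :: "nat \<Rightarrow> nat" and a0 a1 a2 a3 :: nat
  assumes "k > 1"
    and "\<sigma> permutes {0, 1, 2, 3}"
    and "permutiple \<sigma> k [a0, a1, a2, a3]"
  shows "symmetric_permutiple \<sigma> k [a0, a1, a2, a3] \<longleftrightarrow>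
         perfect_permutiple \<sigma> k [a0, a1, a2, a3] \<or> reverse_multiple k [a0, a1, a2, a3]"
proof -
  let ?as = "[a0, a1, a2, a3]"
  define p q r s where "p = ?as ! \<sigma> 0" and "q = ?as ! \<sigma> 1"
    and "r = ?as ! \<sigma> 2" and "s = ?as ! \<sigma> 3"
  note pqrs = p_def q_def r_def s_def
  have all_le_3: "(\<forall>j\<le>3. P j) \<longleftrightarrow> P 0 \<and> P 1 \<and> P 2 \<and> P 3" for P :: "nat \<Rightarrow> bool"
    by (auto simp: le_Suc_eq numeral_3_eq_3 numeral_2_eq_2)
  have len: "length ?as - 1 = 3" by simp
  have perm_as: "permute_list \<tau> ?as = [?as ! \<tau> 0, ?as ! \<tau> 1, ?as ! \<tau> 2, ?as ! \<tau> 3]" for \<tau>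
    by (simp add: permute_list_def upt_rec numeral_3_eq_3 numeral_2_eq_2)
  have \<sigma>_as: "permute_list \<sigma> ?as = [p, q, r, s]"
    unfolding perm_as pqrs ..
  have \<sigma>: "\<sigma> permutes {..<length ?as}" and can: "canonical_cf ?as"
    and can': "canonical_cf [p, q, r, s]"
    and val: "cf_value ?as = real k * cf_value [p, q, r, s]"
    using assms(3) unfolding permutiple_def \<sigma>_as by blast+
  have ms: "{#p, q, r, s#} = {#a0, a1, a2, a3#}"
    using mset_permute_list[OF \<sigma>] by (simp add: \<sigma>_as)
  have pos: "a0 > 0" "a1 > 0" "a2 > 0" "a3 > 0" "p > 0" "q > 0" "r > 0" "s > 0"
    using can can' by (auto simp: canonical_cf_def)
  \<comment> \<open>The conditions for \<open>j\<close> and \<open>3 - j\<close> coincide, leaving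
    two of the four.\<close>
  have sym: "symmetric_permutiple \<sigma> k ?as \<longleftrightarrow> p * s = a0 * a3 \<and> q * r = a1 * a2"
    using assms(3) unfolding symmetric_permutiple_def Let_def len all_le_3
    by (auto simp: pqrs ac_simps)
  have perf: "perfect_permutiple \<sigma> k ?as \<longleftrightarrow>
      a0 = k * p \<and> q = k * a1 \<and> a2 = k * r \<and> s = k * a3"
    using assms(3) unfolding perfect_permutiple_def Let_def len all_le_3
    by (auto simp: pqrs)
  have rev_as: "permute_list \<tau> ?as = [a3, a2, a1, a0]" if "\<forall>j\<le>3. \<tau> j = 3 - j" for \<tau>
    using that unfolding all_le_3 perm_as by simp
  have rev: "reverse_multiple k ?as \<longleftrightarrow> p = a3 \<and> q = a2 \<and> r = a1 \<and> s = a0"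
  proof
    assume "reverse_multiple k ?as"
    then obtain \<tau> where \<tau>: "permutiple \<tau> k ?as" "\<forall>j\<le>3. \<tau> j = 3 - j"
      unfolding reverse_multiple_def Let_def len by blast
    \<comment> \<open>The witness \<open>\<tau>\<close> may differ from \<open>\<sigma>\<close>, but
      both rearrangements have the value of the original divided by \<open>k\<close>.\<close>
    have "canonical_cf [a3, a2, a1, a0]" "cf_value [a3, a2, a1, a0] = cf_value [p, q, r, s]"
      using \<tau>(1) val assms(1) unfolding permutiple_def rev_as[OF \<tau>(2)] by auto
    thus "p = a3 \<and> q = a2 \<and> r = a1 \<and> s = a0"
      using cf_value_inject[OF _ can'] by blast
  next
    assume digits: "p = a3 \<and> q = a2 \<and> r = a1 \<and> s = a0"
    \<comment> \<open>Beyond 3 it must be the identity, as \<open>permutes\<close> demands.\<close>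
    define \<tau> :: "nat \<Rightarrow> nat" where "\<tau> = (\<lambda>j. if j \<le> 3 then 3 - j else j)"
    have \<tau>: "\<forall>j\<le>3. \<tau> j = 3 - j" by (simp add: \<tau>_def)
    have "\<tau> permutes {..<length ?as}"
      unfolding permutes_def by (auto simp: \<tau>_def) presburger+
    hence "permutiple \<tau> k ?as"
      using assms(1) can can' val digits unfolding permutiple_def rev_as[OF \<tau>] by simp
    thus "reverse_multiple k ?as"
      unfolding reverse_multiple_def Let_def len using \<tau> by blast
  qed
  have "(a0 = k*p \<and> q = k*a1 \<and> a2 = k*r \<and> s = k*a3) \<or> (p = a3 \<and> q = a2 \<and> r = a1 \<and> s = a0)"
    if ps: "p * s = a0 * a3" and qr: "q * r = a1 * a2"
  proof -
    let ?N = "\<lambda>a b c d :: nat. a*b*c*d + a*d + 1 + a*b + c*d"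
    let ?D = "\<lambda>b c d :: nat. d * (b*c + 1) + b"
    have "real (?N a0 a1 a2 a3) / real (?D a1 a2 a3) =
        real k * (real (?N p q r s) / real (?D q r s))"
      using val pos by (simp only: cf_value_4)
    moreover have "real (?D a1 a2 a3) \<noteq> 0" "real (?D q r s) \<noteq> 0"
      using pos by (simp_all only: of_nat_eq_0_iff)
    ultimately have "real (?N a0 a1 a2 a3) * real (?D q r s) =
        real k * real (?N p q r s) * real (?D a1 a2 a3)"
      by (metis frac_eq_eq times_divide_eq_right)
    hence "?N a0 a1 a2 a3 * ?D q r s = k * ?N p q r s * ?D a1 a2 a3"
      by (simp only: of_nat_mult[symmetric] of_nat_eq_iff)
    from symmetric_numerators_eq[OF pos(1-4) ps qr this]
    show ?thesis
      by (rule symmetric_digits[OF assms(1) pos(1-4) ms ps qr])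
  qed
  thus ?thesis
    unfolding sym perf rev by auto
qed

end
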